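(* Let $W:\mathbb{R}^2\to[0,\infty)$ be a $C^3$ function vanishing precisely at two distinct points $\mathbf{p}_+,\mathbf{p}_-$. Assume that inside a ball of some radius $r>0$ around $\mathbf{p}_+$, $$W(p)=\lambda|p-\mathbf{p}_+|^2+G(|p-\mathbf{p}_+|^2),$$ with $\lambda>0$ and $G:\mathbb{R}\to\mathbb{R}$ a differentiable function with $G'(t)=o(1)$ and $G(t)=o(t)$ for $t$ near zero. If there exists a heteroclinic traveling wave with speed $\nu\in\mathbb{R}$, then $\nu^2\le8\lambda$.
   Context: Here a heteroclinic traveling wave with speed $\nu$ is a solution $U:\mathbb{R}\to\mathbb{R}^2$ of $$-\nu\,\mathbb{J}U'=U''-\nabla_uW(U)\ \text{ on }(-\infty,\infty),\qquad \mathbb{J}=\begin{pmatrix}0&1\\-1&0\end{pmatrix},$$ with $U(x)\to\mathbf{p}_\pm$ and $U'(x)\to0$ as $x\to\pm\infty$ (no specific rate of decay is assumed). *)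

theory Defs
  imports "HOL-Analysis.Analysis" "HOL-Library.Landau_Symbols"
begin

(* C_k_map k f: f is of class C^k on the whole space.  In finite dimension, continuity of
   the directional derivatives of order k is the same as continuity of the k-th Frechet
   derivative in operator norm; hence the sort euclidean_space of the domain. *)
primrec C_k_map :: "nat \<Rightarrow> ('a::euclidean_space \<Rightarrow> 'b::real_normed_vector) \<Rightarrow> bool" where
  "C_k_map 0 f \<longleftrightarrow> continuous_on UNIV f"
| "C_k_map (Suc k) f \<longleftrightarrow>
     (\<forall>x. f differentiable (at x)) \<and> (\<forall>v. C_k_map k (\<lambda>x. frechet_derivative f (at x) v))"

(* Unspecified at points where f is not differentiable. *)
definition gradient :: "('a::real_inner \<Rightarrow> real) \<Rightarrow> 'a \<Rightarrow> 'a" where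
  "gradient f x = (THE D. GDERIV f x :> D)"

definition J_mat :: "real^2^2" where
  "J_mat = vector [vector [0, 1], vector [-1, 0]]"

(* Classical (twice differentiable) solutions.  The limits at +infinity and -infinity are
   p_plus and p_minus respectively; no rate of convergence is required. *)
definition heteroclinic_wave ::
  "(real^2 \<Rightarrow> real) \<Rightarrow> real \<Rightarrow> real^2 \<Rightarrow> real^2 \<Rightarrow> (real \<Rightarrow> real^2) \<Rightarrow> bool" where
  "heteroclinic_wave W \<nu> p_plus p_minus U \<longleftrightarrow>
     (\<exists>U' U''.
        (\<forall>x. (U has_vector_derivative U' x) (at x)) \<and>
        (\<forall>x. (U' has_vector_derivative U'' x) (at x)) \<and>
        (\<forall>x. - \<nu> *\<^sub>R (J_mat *v U' x) = U'' x - gradient W (U x)) \<and>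
        (U \<longlongrightarrow> p_plus) at_top \<and> (U \<longlongrightarrow> p_minus) at_bot \<and>
        (U' \<longlongrightarrow> 0) at_top \<and> (U' \<longlongrightarrow> 0) at_bot)"

end

theory Submission
  imports Defs
begin

text \<open>
  The proof exhibits two conserved quantities of the profile equation
  \<open>U'' = gradient W U - \<nu> J U'\<close> and compares them near \<open>p_plus\<close>. Write \<open>V = U - p_plus\<close>.

  Since \<open>J\<close> is a rotation by a right angle, the term \<open>\<nu> J U'\<close> does no work, so the energy
  \<open>|U'|^2 / 2 - W U\<close> is constant; it vanishes at infinity, hence \<open>|U'|^2 = 2 * W U\<close>
  (lemma \<open>wave_equipartition\<close>). Close to \<open>p_plus\<close> the potential is radial, so \<open>gradient W U\<close>
  exerts no torque about \<open>p_plus\<close>, and the angular momentum \<open>U' \<bullet> J V\<close> changes only through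
  the term with \<open>\<nu>\<close>, whose contribution is the derivative of \<open>- \<nu>/2 * |V|^2\<close>. Both vanish at
  infinity, hence \<open>U' \<bullet> J V = - \<nu>/2 * |V|^2\<close> for large \<open>x\<close>
  (lemma \<open>wave_angular_momentum\<close>).

  Cauchy-Schwarz now gives \<open>|\<nu>|/2 * |V|^2 \<le> |U'| |V|\<close>, that is,
  \<open>\<nu>^2/4 * |V|^2 \<le> |U'|^2 = 2 * W U = 2 * lam * |V|^2 + o(|V|^2)\<close> where \<open>V \<noteq> 0\<close>. Dividing by
  \<open>|V|^2\<close> and letting \<open>x\<close> tend to infinity yields \<open>\<nu>^2 \<le> 8 * lam\<close>.

  The division requires that \<open>U\<close> does not sit at \<open>p_plus\<close>
  (lemma \<open>wave_avoids_quadratic_well\<close>). Energy conservation also settles this, in place of a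
  uniqueness theorem for the second-order system: \<open>W\<close> vanishes to second order at \<open>p_plus\<close>, so
  \<open>|U'|^2 = 2 * W U\<close> bounds \<open>|V'|\<close> by a multiple of \<open>|V|\<close>, and a wave that once reached
  \<open>p_plus\<close> would stay there for all \<open>x\<close>.
\<close>

section \<open>Gradients and derivatives\<close>

text \<open>
  The definite description in \<open>gradient\<close> denotes: in finite dimension the Frechet derivative is
  represented by a vector (Riesz), and uniquely so.
\<close>

lemma GDERIV_gradient:
  fixes f :: "'a::euclidean_space \<Rightarrow> real"
  assumes "f differentiable (at x)"
  shows "GDERIV f x :> gradient f x"
proof -
  obtain f' where f': "(f has_derivative f') (at x)"
    using assms by (auto simp: differentiable_def)
  then have lin: "linear f'"
    by (rule has_derivative_linear)
  define D where "D = (\<Sum>b\<in>Basis. f' b *\<^sub>R b)"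
  have "f' h = h \<bullet> D" for h
  proof -
    have "f' h = f' (\<Sum>b\<in>Basis. (h \<bullet> b) *\<^sub>R b)"
      by (simp add: euclidean_representation)
    also have "\<dots> = (\<Sum>b\<in>Basis. (h \<bullet> b) * f' b)"
      by (simp add: linear_sum[OF lin] linear_scale[OF lin])
    also have "\<dots> = h \<bullet> D"
      by (simp add: D_def inner_sum_right mult.commute)
    finally show ?thesis .
  qed
  then have "f' = (\<lambda>h. h \<bullet> D)"
    by blast
  then have D: "GDERIV f x :> D"
    using f' by (simp add: gderiv_def)
  have "E = D" if "GDERIV f x :> E" for E
  proof -
    have "(\<lambda>h. h \<bullet> E) = (\<lambda>h. h \<bullet> D)"
      using that D has_derivative_unique unfolding gderiv_def by blast
    then show ?thesis
      by (metis inner_commute vector_eq_rdot)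
  qed
  with D show ?thesis
    unfolding gradient_def by (metis theI)
qed

lemma gradient_eq:
  fixes f :: "'a::euclidean_space \<Rightarrow> real"
  assumes "GDERIV f x :> D"
  shows "gradient f x = D"
proof -
  have "GDERIV f x :> gradient f x"
    using assms by (intro GDERIV_gradient) (auto simp: differentiable_def gderiv_def)
  then have "(\<lambda>h. h \<bullet> gradient f x) = (\<lambda>h. h \<bullet> D)"
    using assms has_derivative_unique unfolding gderiv_def by blast
  then show ?thesis
    by (metis inner_commute vector_eq_rdot)
qed

lemma has_real_derivative_compose_gradient:
  fixes f :: "'a::euclidean_space \<Rightarrow> real"
  assumes "f differentiable (at (u x))" and "(u has_vector_derivative v) (at x)"
  shows "((\<lambda>x. f (u x)) has_real_derivative v \<bullet> gradient f (u x)) (at x)"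
proof -
  have "(f has_derivative (\<lambda>h. h \<bullet> gradient f (u x))) (at (u x))"
    using GDERIV_gradient[OF assms(1)] by (simp add: gderiv_def)
  from diff_chain_at[OF assms(2)[unfolded has_vector_derivative_def] this]
  show ?thesis
    by (simp add: has_field_derivative_def o_def mult.commute[of _ "v \<bullet> _"] mult_commute_abs)
qed

lemma has_real_derivative_inner:
  fixes u v :: "real \<Rightarrow> 'a::real_inner"
  assumes "(u has_vector_derivative u') (at x)" and "(v has_vector_derivative v') (at x)"
  shows "((\<lambda>x. u x \<bullet> v x) has_real_derivative u x \<bullet> v' + u' \<bullet> v x) (at x)"
proof -
  have "(\<lambda>h. u x \<bullet> (h *\<^sub>R v') + (h *\<^sub>R u') \<bullet> v x) = (*) (u x \<bullet> v' + u' \<bullet> v x)"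
    by (simp add: fun_eq_iff algebra_simps)
  then show ?thesis
    using has_derivative_inner[OF assms[unfolded has_vector_derivative_def]]
    by (simp add: has_field_derivative_def)
qed

lemma zero_derivative_tendsto_at_top:
  fixes f :: "real \<Rightarrow> real"
  assumes deriv: "\<And>x. x \<ge> a \<Longrightarrow> (f has_real_derivative 0) (at x)"
    and lim: "(f \<longlongrightarrow> c) at_top" and "x \<ge> a"
  shows "f x = c"
proof -
  have "\<exists>k. \<forall>y\<in>{a..}. f y = k"
    by (rule has_field_derivative_zero_constant)
       (auto intro: has_field_derivative_at_within deriv)
  then have const: "f y = f x" if "y \<ge> x" for y
    using that \<open>x \<ge> a\<close> by (metis atLeast_iff order_trans)
  have "eventually (\<lambda>y. f y = f x) at_top"
    using eventually_ge_at_top[of x] by (rule eventually_mono) (rule const)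
  from lim[unfolded tendsto_cong[OF this]] have "((\<lambda>_::real. f x) \<longlongrightarrow> c) at_top" .
  then show ?thesis
    by (simp add: tendsto_const_iff)
qed

text \<open>
  The differential form of Gronwall's inequality: \<open>f x * exp (- K * x)\<close> is nonincreasing, which
  propagates the zero to the right, and \<open>f x * exp (K * x)\<close> is nondecreasing, which propagates it
  to the left.
\<close>

lemma zero_propagates_of_derivative_bound:
  fixes f f' :: "real \<Rightarrow> real"
  assumes S: "is_interval S"
    and deriv: "\<And>x. x \<in> S \<Longrightarrow> (f has_real_derivative f' x) (at x)"
    and bound: "\<And>x. x \<in> S \<Longrightarrow> \<bar>f' x\<bar> \<le> K * f x"
    and nonneg: "\<And>x. x \<in> S \<Longrightarrow> 0 \<le> f x"
    and "a \<in> S" "f a = 0" "x \<in> S"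
  shows "f x = 0"
proof -
  have d: "((\<lambda>y. f y * exp (c * y)) has_real_derivative (f' y + c * f y) * exp (c * y)) (at y)"
    if "y \<in> S" for y c
    by (rule derivative_eq_intros deriv[OF that] refl)+ (simp add: algebra_simps)
  have between: "y \<in> S" if "u \<in> S" "v \<in> S" "u \<le> y" "y \<le> v" for u v y
    using S that unfolding is_interval_1 by blast
  have "f x \<le> 0"
  proof (cases "a \<le> x")
    case True
    have "f x * exp (- K * x) \<le> f a * exp (- K * a)"
    proof (rule DERIV_nonpos_imp_nonincreasing[OF True])
      fix y assume "a \<le> y" "y \<le> x"
      then have "y \<in> S" using between assms by blast
      with d[of y "- K"] bound[of y]
      show "\<exists>D. ((\<lambda>y. f y * exp (- K * y)) has_real_derivative D) (at y) \<and> D \<le> 0"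
        by (intro exI[of _ "(f' y + - K * f y) * exp (- K * y)"])
           (auto simp: mult_le_0_iff abs_le_iff)
    qed
    with \<open>f a = 0\<close> show ?thesis
      by (simp add: mult_le_0_iff)
  next
    case False
    then have le: "x \<le> a" by simp
    have "f x * exp (K * x) \<le> f a * exp (K * a)"
    proof (rule DERIV_nonneg_imp_nondecreasing[OF le])
      fix y assume "x \<le> y" "y \<le> a"
      then have "y \<in> S" using between assms by blast
      with d[of y K] bound[of y]
      show "\<exists>D. ((\<lambda>y. f y * exp (K * y)) has_real_derivative D) (at y) \<and> 0 \<le> D"
        by (intro exI[of _ "(f' y + K * f y) * exp (K * y)"])
           (auto simp: zero_le_mult_iff abs_le_iff)
    qed
    with \<open>f a = 0\<close> show ?thesis
      by (simp add: mult_le_0_iff)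
  qed
  with nonneg[OF \<open>x \<in> S\<close>] show ?thesis
    by simp
qed

section \<open>The rotation by a right angle\<close>

lemma J_mat_apply: "J_mat *v v = vector [v $ 2, - v $ 1]"
  by (simp add: J_mat_def vec_eq_iff forall_2 matrix_vector_mult_def sum_2)

lemma inner_J_mat_self: "v \<bullet> (J_mat *v v) = 0"
  by (simp add: J_mat_apply inner_vec_def sum_2 mult.commute)

lemma inner_J_mat_J_mat: "(J_mat *v v) \<bullet> (J_mat *v w) = v \<bullet> w"
  by (simp add: J_mat_apply inner_vec_def sum_2 add.commute)

lemma norm_J_mat: "norm (J_mat *v v) = norm v"
  by (simp add: norm_eq_sqrt_inner inner_J_mat_J_mat)

section \<open>The conserved quantities\<close>

text \<open>
  The energy \<open>U' \<bullet> U' - 2 * W U\<close> is conserved because \<open>J U'\<close> is orthogonal to \<open>U'\<close>.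
\<close>

lemma wave_equipartition:
  fixes W :: "real^2 \<Rightarrow> real"
  assumes W_diff: "\<And>p. W differentiable (at p)"
    and U': "\<And>x. (U has_vector_derivative U' x) (at x)"
    and U'': "\<And>x. (U' has_vector_derivative U'' x) (at x)"
    and eq: "\<And>x. - \<nu> *\<^sub>R (J_mat *v U' x) = U'' x - gradient W (U x)"
    and lim: "(U \<longlongrightarrow> p) at_top" "(U' \<longlongrightarrow> 0) at_top"
    and Wp: "W p = 0"
  shows "(norm (U' x))\<^sup>2 = 2 * W (U x)"
proof -
  define E where "E = (\<lambda>x. U' x \<bullet> U' x - 2 * W (U x))"
  have "(E has_real_derivative 0) (at y)" for y
  proof -
    have "U'' y = gradient W (U y) - \<nu> *\<^sub>R (J_mat *v U' y)"
      using eq[of y] by (simp add: algebra_simps)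
    then have "U' y \<bullet> U'' y = U' y \<bullet> gradient W (U y)"
      by (simp add: inner_diff_right inner_J_mat_self)
    then show ?thesis
      unfolding E_def
      by (auto intro!: derivative_eq_intros has_real_derivative_inner U'' 
            has_real_derivative_compose_gradient W_diff U' simp: inner_commute)
  qed
  moreover have "(E \<longlongrightarrow> 0) at_top"
  proof -
    have "isCont W p"
      using W_diff differentiable_imp_continuous_within by blast
    then have "((\<lambda>x. W (U x)) \<longlongrightarrow> 0) at_top"
      using isCont_tendsto_compose lim(1) Wp by metis
    then have "(E \<longlongrightarrow> (0 :: real^2) \<bullet> 0 - 2 * 0) at_top"
      unfolding E_def by (intro tendsto_intros lim)
    then show ?thesis by simp
  qed
  ultimately have "E x = 0"
    using zero_derivative_tendsto_at_top[of x E 0 x] by simp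
  then show ?thesis
    by (simp add: E_def power2_norm_eq_inner)
qed

text \<open>
  A gradient that is parallel to \<open>U - p\<close> is orthogonal to \<open>J (U - p)\<close>, so the derivative of
  \<open>U' \<bullet> J (U - p)\<close> reduces to \<open>- \<nu> * ((U - p) \<bullet> U')\<close>.
\<close>

lemma wave_angular_momentum:
  fixes W :: "real^2 \<Rightarrow> real"
  assumes U': "\<And>x. (U has_vector_derivative U' x) (at x)"
    and U'': "\<And>x. (U' has_vector_derivative U'' x) (at x)"
    and eq: "\<And>x. - \<nu> *\<^sub>R (J_mat *v U' x) = U'' x - gradient W (U x)"
    and lim: "(U \<longlongrightarrow> p) at_top" "(U' \<longlongrightarrow> 0) at_top"
    and radial: "\<And>x. x \<ge> a \<Longrightarrow> \<exists>c. gradient W (U x) = c *\<^sub>R (U x - p)"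
    and "x \<ge> a"
  shows "U' x \<bullet> (J_mat *v (U x - p)) = - (\<nu> / 2) * (norm (U x - p))\<^sup>2"
proof -
  have V': "((\<lambda>x. U x - p) has_vector_derivative U' y) (at y)" for y
    using has_vector_derivative_diff[OF U' has_vector_derivative_const] by simp
  have JV': "((\<lambda>x. J_mat *v (U x - p)) has_vector_derivative J_mat *v U' y) (at y)" for y
    by (rule bounded_linear.has_vector_derivative[OF matrix_vector_mul_bounded_linear V'])
  define M where "M = (\<lambda>x. U' x \<bullet> (J_mat *v (U x - p)) + (\<nu> / 2) * ((U x - p) \<bullet> (U x - p)))"
  have "(M has_real_derivative 0) (at y)" if "y \<ge> a" for y
  proof -
    obtain c where "gradient W (U y) = c *\<^sub>R (U y - p)"
      using radial \<open>y \<ge> a\<close> by blast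
    with eq[of y] have "U'' y = c *\<^sub>R (U y - p) - \<nu> *\<^sub>R (J_mat *v U' y)"
      by (simp add: algebra_simps)
    then have "U'' y \<bullet> (J_mat *v (U y - p)) =
        c * ((U y - p) \<bullet> (J_mat *v (U y - p))) - \<nu> * ((J_mat *v U' y) \<bullet> (J_mat *v (U y - p)))"
      by (simp only: inner_diff_left inner_scaleR_left)
    then have torque: "U'' y \<bullet> (J_mat *v (U y - p)) = - \<nu> * ((U y - p) \<bullet> U' y)"
      by (simp only: inner_J_mat_self inner_J_mat_J_mat) (simp add: inner_commute)
    have "(M has_real_derivative
        (U' y \<bullet> (J_mat *v U' y) + U'' y \<bullet> (J_mat *v (U y - p))) +
        (\<nu> / 2) * ((U y - p) \<bullet> U' y + U' y \<bullet> (U y - p))) (at y)"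
      unfolding M_def
      by (intro DERIV_add DERIV_cmult has_real_derivative_inner U'' JV' V')
    then show ?thesis
      by (simp add: torque inner_J_mat_self inner_commute)
  qed
  moreover have "(M \<longlongrightarrow> 0) at_top"
  proof -
    have V: "((\<lambda>x. U x - p) \<longlongrightarrow> 0) at_top"
      using lim(1) by (simp add: LIM_zero)
    have "((\<lambda>x. J_mat *v (U x - p)) \<longlongrightarrow> J_mat *v 0) at_top"
      by (rule bounded_linear.tendsto[OF matrix_vector_mul_bounded_linear V])
    then have "(M \<longlongrightarrow> 0 \<bullet> (J_mat *v 0) + (\<nu> / 2) * ((0 :: real^2) \<bullet> 0)) at_top"
      unfolding M_def by (intro tendsto_intros V lim)
    then show ?thesis by simp
  qed
  ultimately have "M x = 0"
    using zero_derivative_tendsto_at_top[of a M 0 x] \<open>x \<ge> a\<close> by blast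
  then show ?thesis
    by (simp add: M_def power2_norm_eq_inner)
qed

section \<open>The wave does not reach the well\<close>

text \<open>
  Equipartition turns the quadratic bound on \<open>W\<close> into \<open>|U'| \<le> K * |U - p|\<close> near \<open>p\<close>, so by
  Gronwall's inequality the set of \<open>x\<close> with \<open>U x = p\<close> is open. It is also closed, hence empty
  or the whole line.
\<close>

lemma wave_avoids_quadratic_well:
  fixes U U' :: "real \<Rightarrow> 'a::real_inner" and W :: "'a \<Rightarrow> real"
  assumes U': "\<And>x. (U has_vector_derivative U' x) (at x)"
    and energy: "\<And>x. (norm (U' x))\<^sup>2 = 2 * W (U x)"
    and "\<delta> > 0" and quad: "\<And>q. q \<in> ball p \<delta> \<Longrightarrow> W q \<le> C * (norm (q - p))\<^sup>2"
    and "U z \<noteq> p"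
  shows "U x \<noteq> p"
proof
  assume "U x = p"
  define S where "S = {x. U x = p}"
  define K where "K = sqrt (2 * \<bar>C\<bar>)"
  have cont: "continuous_on UNIV U"
    by (intro continuous_at_imp_continuous_on ballI has_vector_derivative_continuous[OF U'])
  have slope: "norm (U' y) \<le> K * norm (U y - p)" if "U y \<in> ball p \<delta>" for y
  proof (rule power2_le_imp_le)
    have "(norm (U' y))\<^sup>2 \<le> 2 * (C * (norm (U y - p))\<^sup>2)"
      using quad[OF that] energy[of y] by simp
    also have "\<dots> \<le> (2 * \<bar>C\<bar>) * (norm (U y - p))\<^sup>2"
      by (simp add: mult_right_mono)
    also have "\<dots> = (K * norm (U y - p))\<^sup>2"
      by (simp add: K_def power_mult_distrib)
    finally show "(norm (U' y))\<^sup>2 \<le> (K * norm (U y - p))\<^sup>2" .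
  qed (simp add: K_def)
  have "closed S"
    unfolding S_def using closed_Collect_eq[OF cont continuous_on_const] by simp
  moreover have "open S"
    unfolding open_dist
  proof
    fix a assume "a \<in> S"
    then have "U a = p" by (simp add: S_def)
    have "isCont U a"
      using cont by (simp add: continuous_on_eq_continuous_at)
    then obtain e where "e > 0" and e: "\<And>y. dist y a < e \<Longrightarrow> dist (U y) (U a) < \<delta>"
      using \<open>\<delta> > 0\<close> unfolding continuous_at_eps_delta by metis
    have V': "((\<lambda>x. U x - p) has_vector_derivative U' y) (at y)" for y
      using has_vector_derivative_diff[OF U' has_vector_derivative_const] by simp
    have "(U y - p) \<bullet> (U y - p) = 0" if "y \<in> ball a e" for y
    proof (rule zero_propagates_of_derivative_bound[where S = "ball a e" and a = a
            and K = "2 * K" and f = "\<lambda>y. (U y - p) \<bullet> (U y - p)"])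
      fix t assume "t \<in> ball a e"
      then have "U t \<in> ball p \<delta>"
        using e[of t] \<open>U a = p\<close> by (simp add: dist_commute)
      show "((\<lambda>y. (U y - p) \<bullet> (U y - p)) has_real_derivative
          (U t - p) \<bullet> U' t + U' t \<bullet> (U t - p)) (at t)"
        by (rule has_real_derivative_inner[OF V' V'])
      have "\<bar>(U t - p) \<bullet> U' t + U' t \<bullet> (U t - p)\<bar> = 2 * \<bar>(U t - p) \<bullet> U' t\<bar>"
        by (simp add: inner_commute)
      also have "\<dots> \<le> 2 * (norm (U t - p) * (K * norm (U t - p)))"
        using Cauchy_Schwarz_ineq2[of "U t - p" "U' t"]
          mult_left_mono[OF slope[OF \<open>U t \<in> ball p \<delta>\<close>] norm_ge_zero[of "U t - p"]]
        by linarith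
      also have "\<dots> = 2 * K * ((U t - p) \<bullet> (U t - p))"
        by (simp add: power2_norm_eq_inner[symmetric] power2_eq_square)
      finally show "\<bar>(U t - p) \<bullet> U' t + U' t \<bullet> (U t - p)\<bar>
          \<le> 2 * K * ((U t - p) \<bullet> (U t - p))" .
    qed (use that \<open>e > 0\<close> \<open>U a = p\<close> in \<open>auto simp: is_interval_ball_real\<close>)
    then show "\<exists>e>0. \<forall>y. dist y a < e \<longrightarrow> y \<in> S"
      using \<open>e > 0\<close> by (auto simp: S_def dist_commute intro!: exI[of _ e])
  qed
  moreover have "x \<in> S" "z \<notin> S"
    using \<open>U x = p\<close> \<open>U z \<noteq> p\<close> by (auto simp: S_def)
  ultimately show False
    using clopen[of S] by blast
qed

section \<open>The bound on the speed\<close>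

lemma radial_gradient_parallel:
  fixes W :: "'a::euclidean_space \<Rightarrow> real"
  assumes W_local: "\<And>q. q \<in> ball p r \<Longrightarrow> W q = g ((norm (q - p))\<^sup>2)"
    and g_diff: "\<And>t. g differentiable (at t)"
    and q: "q \<in> ball p r"
  shows "\<exists>c. gradient W q = c *\<^sub>R (q - p)"
proof -
  define d where "d = deriv g ((norm (q - p))\<^sup>2)"
  have g': "(g has_real_derivative d) (at ((norm (q - p))\<^sup>2))"
    using g_diff unfolding d_def
    by (metis DERIV_deriv_iff_real_differentiable)
  have "((\<lambda>q. (norm (q - p))\<^sup>2) has_derivative (\<lambda>h. h \<bullet> (2 *\<^sub>R (q - p)))) (at q)"
    unfolding power2_norm_eq_inner
    by (auto intro!: derivative_eq_intros simp: inner_commute algebra_simps)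
  from diff_chain_at[OF this g'[unfolded has_field_derivative_def]]
  have "((\<lambda>q. g ((norm (q - p))\<^sup>2)) has_derivative (\<lambda>h. h \<bullet> ((2 * d) *\<^sub>R (q - p)))) (at q)"
    by (simp add: o_def algebra_simps)
  then have "(W has_derivative (\<lambda>h. h \<bullet> ((2 * d) *\<^sub>R (q - p)))) (at q)"
    by (rule has_derivative_transform_within_open[OF _ open_ball q]) (simp add: W_local)
  then have "GDERIV W q :> (2 * d) *\<^sub>R (q - p)"
    by (simp add: gderiv_def)
  then show ?thesis
    using gradient_eq by blast
qed

theorem proposition4p15:
  fixes W :: "real^2 \<Rightarrow> real"
    and p_plus p_minus :: "real^2"
    and r lam \<nu> :: real
    and G :: "real \<Rightarrow> real"
  assumes W_C3: "C_k_map 3 W"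
    and W_nonneg: "\<And>p. W p \<ge> 0"
    and wells_distinct: "p_plus \<noteq> p_minus"
    and W_zero_iff: "\<And>p. W p = 0 \<longleftrightarrow> p = p_plus \<or> p = p_minus"
    and r_pos: "r > 0"
    and lam_pos: "lam > 0"
    and G_diff: "\<And>t. G differentiable (at t)"
    and G'_small: "deriv G \<in> o[at 0](\<lambda>_. 1)"
    and G_small: "G \<in> o[at 0](\<lambda>t. t)"
    and W_local: "\<And>p. p \<in> ball p_plus r \<Longrightarrow>
                    W p = lam * (norm (p - p_plus))\<^sup>2 + G ((norm (p - p_plus))\<^sup>2)"
    and wave: "\<exists>U. heteroclinic_wave W \<nu> p_plus p_minus U"
  shows "\<nu>\<^sup>2 \<le> 8 * lam"
proof -
  obtain U U' U'' where
        U': "\<And>x. (U has_vector_derivative U' x) (at x)"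
    and U'': "\<And>x. (U' has_vector_derivative U'' x) (at x)"
    and eq: "\<And>x. - \<nu> *\<^sub>R (J_mat *v U' x) = U'' x - gradient W (U x)"
    and lim: "(U \<longlongrightarrow> p_plus) at_top" "(U' \<longlongrightarrow> 0) at_top"
    and lim_bot: "(U \<longlongrightarrow> p_minus) at_bot"
    using wave unfolding heteroclinic_wave_def by blast
  have W_diff: "W differentiable (at p)" for p
    using W_C3 by (simp add: numeral_3_eq_3)
  have Wp: "W p_plus = 0"
    using W_zero_iff by blast
  have energy: "(norm (U' x))\<^sup>2 = 2 * W (U x)" for x
    by (rule wave_equipartition[OF W_diff U' U'' eq lim Wp])
  have G0: "G 0 = 0"
    using W_local[of p_plus] Wp r_pos by simp

  have quad: "\<exists>\<delta>>0. \<delta> \<le> r \<and>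
      (\<forall>q\<in>ball p_plus \<delta>. W q \<le> (lam + \<epsilon>) * (norm (q - p_plus))\<^sup>2)"
    if "\<epsilon> > 0" for \<epsilon>
  proof -
    have "eventually (\<lambda>t. norm (G t) \<le> \<epsilon> * norm t) (at 0)"
      using landau_o.smallD[OF G_small \<open>\<epsilon> > 0\<close>] by simp
    then obtain d where "d > 0" and d: "\<And>t. t \<noteq> 0 \<Longrightarrow> \<bar>t\<bar> < d \<Longrightarrow> \<bar>G t\<bar> \<le> \<epsilon> * \<bar>t\<bar>"
      by (auto simp: eventually_at)
    have "W q \<le> (lam + \<epsilon>) * (norm (q - p_plus))\<^sup>2"
      if q: "q \<in> ball p_plus (min r (sqrt d))" for q
    proof -
      have "norm (q - p_plus) < sqrt d"
        using q by (simp add: dist_norm norm_minus_commute)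
      then have "(norm (q - p_plus))\<^sup>2 < d"
        using \<open>d > 0\<close> real_less_rsqrt real_sqrt_less_iff
        by (metis norm_ge_zero real_sqrt_abs abs_of_nonneg)
      then have "\<bar>G ((norm (q - p_plus))\<^sup>2)\<bar> \<le> \<epsilon> * (norm (q - p_plus))\<^sup>2"
        using d[of "(norm (q - p_plus))\<^sup>2"] G0 by (cases "q = p_plus") auto
      then show ?thesis
        using W_local[of q] q by (simp add: algebra_simps)
    qed
    then show ?thesis
      using \<open>d > 0\<close> r_pos by (intro exI[of _ "min r (sqrt d)"]) auto
  qed

  have off_well: "U x \<noteq> p_plus" for x
  proof -
    obtain z where "U z \<noteq> p_plus"
    proof -
      have "eventually (\<lambda>x. U x \<noteq> p_plus) at_bot"
        using tendsto_imp_eventually_ne[OF lim_bot] wells_distinct by metis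
      then show ?thesis
        using that by (auto simp: eventually_at_bot_linorder)
    qed
    moreover obtain \<delta> where "\<delta> > 0"
      "\<And>q. q \<in> ball p_plus \<delta> \<Longrightarrow> W q \<le> (lam + 1) * (norm (q - p_plus))\<^sup>2"
      using quad[of 1] by auto
    ultimately show ?thesis
      using wave_avoids_quadratic_well[OF U' energy] by blast
  qed

  have "\<nu>\<^sup>2 / 8 \<le> lam + \<epsilon>" if eps: "\<epsilon> > 0" for \<epsilon>
  proof -
    obtain \<delta> where "\<delta> > 0" "\<delta> \<le> r" and
      W_le: "\<And>q. q \<in> ball p_plus \<delta> \<Longrightarrow> W q \<le> (lam + \<epsilon>) * (norm (q - p_plus))\<^sup>2"
      using quad[OF eps] by blast
    have "eventually (\<lambda>x. dist (U x) p_plus < \<delta>) at_top"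
      using tendstoD[OF lim(1) \<open>\<delta> > 0\<close>] .
    then obtain a where a: "\<And>x. x \<ge> a \<Longrightarrow> U x \<in> ball p_plus \<delta>"
      by (auto simp: eventually_at_top_linorder dist_commute)
    have "\<exists>c. gradient W (U x) = c *\<^sub>R (U x - p_plus)" if "x \<ge> a" for x
      using a[OF that] \<open>\<delta> \<le> r\<close>
      by (intro radial_gradient_parallel[where g = "\<lambda>t. lam * t + G t" and r = r])
         (auto simp: W_local intro!: derivative_intros G_diff)
    from wave_angular_momentum[OF U' U'' eq lim this order_refl]
    have mom: "U' a \<bullet> (J_mat *v (U a - p_plus)) = - (\<nu> / 2) * (norm (U a - p_plus))\<^sup>2" .
    define \<rho> where "\<rho> = norm (U a - p_plus)"
    have "\<rho> > 0"
      using off_well[of a] by (simp add: \<rho>_def)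
    have "\<bar>\<nu>\<bar> / 2 * \<rho> * \<rho> \<le> norm (U' a) * \<rho>"
      using Cauchy_Schwarz_ineq2[of "U' a" "J_mat *v (U a - p_plus)"] mom
      by (simp add: norm_J_mat \<rho>_def power2_eq_square abs_mult)
    then have "\<bar>\<nu>\<bar> / 2 * \<rho> \<le> norm (U' a)"
      using \<open>\<rho> > 0\<close> by simp
    then have "(\<bar>\<nu>\<bar> / 2 * \<rho>)\<^sup>2 \<le> (norm (U' a))\<^sup>2"
      using \<open>\<rho> > 0\<close> by (intro power_mono) auto
    also have "\<dots> \<le> 2 * ((lam + \<epsilon>) * \<rho>\<^sup>2)"
      using energy[of a] W_le[OF a[OF order_refl]] by (simp add: \<rho>_def)
    finally have "(\<nu>\<^sup>2 / 8) * \<rho>\<^sup>2 \<le> (lam + \<epsilon>) * \<rho>\<^sup>2"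
      by (simp add: power_mult_distrib power_divide)
    then show ?thesis
      using \<open>\<rho> > 0\<close> by simp
  qed
  then have "\<nu>\<^sup>2 / 8 \<le> lam"
    by (rule field_le_epsilon)
  then show ?thesis
    by simp
qed

end
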